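(* Let $T=M\times_\Phi^qS$ be a tight twisted product. For an $\mathscr H^M$-class $H$ of $M$ (recall $\mathscr H^M=\mathscr D^M$) and a $\mathscr D^S$-class $D$ of $S$, the following are equivalent: (i) the $\mathscr D^T$-class $H\times D$ is regular; (ii) $H$ is a group, $D$ is regular, and $H=H+\Phi(D)q$; (iii) $H$ is a group, $D$ is regular, and $i\leq_{\mathscr J}^M\Phi(D)q$ for some (equivalently all) $i\in H$; (iv) $H$ is a group, $D$ is regular, and either $\Phi(D)=0$ or else $i\leq_{\mathscr J}^Mq$ for some (equivalently all) $i\in H$. Every group $\mathscr H^T$-class contained in a regular $\mathscr D^T$-class $H\times D$ is isomorphic to the direct product $(H,+)\times(G,\cdot)$ for some (equivalently, any) group $\mathscr H^S$-class $G\subseteq D$.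
   Context: $S$ is a monoid (multiplicative, identity $1$); $M$ is a commutative monoid (additive, identity $0$); $q\in M$ is fixed; $\mathbb N=\{0,1,2,\dots\}$. A twisting of $S$ is a map $\Phi:S\times S\to\mathbb N$ with $\Phi(a,b)+\Phi(ab,c)=\Phi(a,bc)+\Phi(b,c)$ for all $a,b,c\in S$. It is tight if (a) for all $a,b\in S$ there is $a'\in S$ with $ab=a'b$ and $\Phi(a',b)=0$; and (b) for all $a,b\in S$ there is $b'\in S$ with $ab=ab'$ and $\Phi(a,b')=0$. The twisted product $M\times_\Phi^qS$ is the semigroup with underlying set $M\times S$ and product $(i,a)(j,b)=(i+j+\Phi(a,b)q,\,ab)$, where for $n\in\mathbb N$, $nq$ is the $n$-fold sum of $q$ in $M$ (and $0q=0$); it is called tight if $\Phi$ is tight (in which case it is a monoid with identity $(0,1)$). Superscripts $M,S,T$ indicate in which monoid Green's relations are taken. On a monoid $X$: $a\,\mathscr L\,b\iff Xa=Xb$, $a\,\mathscr R\,b\iff aX=bX$, $\mathscr H=\mathscr L\cap\mathscr R$, $\mathscr D=\mathscr L\vee\mathscr R$ (join of equivalences), and $a\leq_{\mathscr J}b\iff XaX\subseteq XbX$; in $M$, $i\leq_{\mathscr J}^Mj$ means $i=j+l$ for some $l\in M$. The $\mathscr D^T$-classes of $T$ are exactly the sets $H\times D$ with $H$ an $\mathscr H^M$-class and $D$ a $\mathscr D^S$-class. An element $a$ of a semigroup $X$ is regular if $a\in aXa$; a $\mathscr D$-class is regular if all (equivalently, some) of its elements are regular. An $\mathscr H$-class is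 a group iff it contains an idempotent. For a regular $\mathscr D^S$-class $D$, $\Phi(D)=\min\{\Phi(e,e):e\in E(D)\}$, where $E(D)$ is the (non-empty) set of idempotents in $D$. $H+k=\{h+k:h\in H\}$. *)

theory Defs
  imports "HOL-Algebra.Coset"
begin

text \<open>
  Monoids are records of the session HOL-Algebra, which are written multiplicatively. The additive
  commutative monoid M of a twisted product is such a record too: its sum \<open>i + j\<close> is
  \<open>i \<otimes>\<^bsub>M\<^esub> j\<close>, its identity 0 is \<open>\<one>\<^bsub>M\<^esub>\<close>, the multiple
  \<open>n q\<close> is \<open>q [^]\<^bsub>M\<^esub> n\<close>, and the translate \<open>H + k\<close> is \<open>H #>\<^bsub>M\<^esub> k\<close>.
\<close>

definition twisting :: "('s, 'y) monoid_scheme \<Rightarrow> ('s \<Rightarrow> 's \<Rightarrow> nat) \<Rightarrow> bool" where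
  "twisting S \<Phi> \<longleftrightarrow>
    (\<forall>a\<in>carrier S. \<forall>b\<in>carrier S. \<forall>c\<in>carrier S.
      \<Phi> a b + \<Phi> (a \<otimes>\<^bsub>S\<^esub> b) c = \<Phi> a (b \<otimes>\<^bsub>S\<^esub> c) + \<Phi> b c)"

definition tight_twisting :: "('s, 'y) monoid_scheme \<Rightarrow> ('s \<Rightarrow> 's \<Rightarrow> nat) \<Rightarrow> bool" where
  "tight_twisting S \<Phi> \<longleftrightarrow> twisting S \<Phi> \<and>
    (\<forall>a\<in>carrier S. \<forall>b\<in>carrier S.
      \<exists>a'\<in>carrier S. a \<otimes>\<^bsub>S\<^esub> b = a' \<otimes>\<^bsub>S\<^esub> b \<and> \<Phi> a' b = 0) \<and>
    (\<forall>a\<in>carrier S. \<forall>b\<in>carrier S.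
      \<exists>b'\<in>carrier S. a \<otimes>\<^bsub>S\<^esub> b = a \<otimes>\<^bsub>S\<^esub> b' \<and> \<Phi> a b' = 0)"

text \<open>The field \<open>one\<close> is an identity of the twisted product when the twisting is tight.\<close>

definition twisted_product ::
  "('m, 'x) monoid_scheme \<Rightarrow> 'm \<Rightarrow> ('s \<Rightarrow> 's \<Rightarrow> nat) \<Rightarrow> ('s, 'y) monoid_scheme \<Rightarrow> ('m \<times> 's) monoid" where
  "twisted_product M q \<Phi> S =
    \<lparr>carrier = carrier M \<times> carrier S,
     mult = (\<lambda>(i, a) (j, b). (i \<otimes>\<^bsub>M\<^esub> j \<otimes>\<^bsub>M\<^esub> (q [^]\<^bsub>M\<^esub> \<Phi> a b), a \<otimes>\<^bsub>S\<^esub> b)),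
     one = (\<one>\<^bsub>M\<^esub>, \<one>\<^bsub>S\<^esub>)\<rparr>"

definition green_L :: "('a, 'x) monoid_scheme \<Rightarrow> ('a \<times> 'a) set" where
  "green_L X = {(a, b). a \<in> carrier X \<and> b \<in> carrier X \<and>
    carrier X #>\<^bsub>X\<^esub> a = carrier X #>\<^bsub>X\<^esub> b}"

definition green_R :: "('a, 'x) monoid_scheme \<Rightarrow> ('a \<times> 'a) set" where
  "green_R X = {(a, b). a \<in> carrier X \<and> b \<in> carrier X \<and>
    a <#\<^bsub>X\<^esub> carrier X = b <#\<^bsub>X\<^esub> carrier X}"

definition green_H :: "('a, 'x) monoid_scheme \<Rightarrow> ('a \<times> 'a) set" where
  "green_H X = green_L X \<inter> green_R X"

definition green_D :: "('a, 'x) monoid_scheme \<Rightarrow> ('a \<times> 'a) set" where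
  "green_D X = \<Inter>{E. equiv (carrier X) E \<and> green_L X \<union> green_R X \<subseteq> E}"

definition green_J_le :: "('a, 'x) monoid_scheme \<Rightarrow> 'a \<Rightarrow> 'a \<Rightarrow> bool" where
  "green_J_le X a b \<longleftrightarrow>
    (carrier X #>\<^bsub>X\<^esub> a) <#>\<^bsub>X\<^esub> carrier X \<subseteq> (carrier X #>\<^bsub>X\<^esub> b) <#>\<^bsub>X\<^esub> carrier X"

definition regular_element :: "('a, 'x) monoid_scheme \<Rightarrow> 'a \<Rightarrow> bool" where
  "regular_element X a \<longleftrightarrow> a \<in> (a <#\<^bsub>X\<^esub> carrier X) #>\<^bsub>X\<^esub> a"

definition regular_D_class :: "('a, 'x) monoid_scheme \<Rightarrow> 'a set \<Rightarrow> bool" where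
  "regular_D_class X D \<longleftrightarrow> D \<in> carrier X // green_D X \<and> (\<forall>a\<in>D. regular_element X a)"

text \<open>
  The subset K is a group under the operation of X; its identity need not be that of X.
\<close>

definition is_group_in :: "('a, 'x) monoid_scheme \<Rightarrow> 'a set \<Rightarrow> bool" where
  "is_group_in X K \<longleftrightarrow> (\<exists>e. group (X\<lparr>carrier := K, one := e\<rparr>))"

definition group_H_class :: "('a, 'x) monoid_scheme \<Rightarrow> 'a set \<Rightarrow> bool" where
  "group_H_class X K \<longleftrightarrow> K \<in> carrier X // green_H X \<and> is_group_in X K"

text \<open>
  The set of idempotents of D may be infinite, so the minimum is taken with \<open>Inf\<close>, which on a
  non-empty set of natural numbers is the least element (\<open>Min\<close> is only meaningful on finite sets).
\<close>

definition class_twist :: "('s, 'y) monoid_scheme \<Rightarrow> ('s \<Rightarrow> 's \<Rightarrow> nat) \<Rightarrow> 's set \<Rightarrow> nat" where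
  "class_twist S \<Phi> D = Inf {\<Phi> e e | e. e \<in> D \<and> e \<otimes>\<^bsub>S\<^esub> e = e}"

text \<open>
  Isomorphism of subsets that are groups under the operations of the ambient monoids. Only
  \<open>carrier\<close> and \<open>mult\<close> enter into the relation \<open>\<cong>\<close>, so the field
  \<open>one\<close>, still that of the ambient monoid, is irrelevant.
\<close>

abbreviation restricted_to :: "('a, 'x) monoid_scheme \<Rightarrow> 'a set \<Rightarrow> ('a, 'x) monoid_scheme"
    (infixl "\<restriction>" 90) where
  "X \<restriction> K \<equiv> X\<lparr>carrier := K\<rparr>"

end

theory Submission
  imports Defs
begin

text \<open>
  Tightness removes the twist when solving \<open>x = z y\<close> or \<open>x = y z\<close> in the twisted product, so
  Green's relations there are products of those of the factors. A class \<open>H \<times> D\<close> is therefore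
  regular iff it contains an idempotent, that is, a pair \<open>(i, e)\<close> with \<open>e\<close> idempotent and
  \<open>i = 2i + \<Phi>(e,e)q\<close>. Such an \<open>i\<close> forces \<open>H\<close> to be a group and \<open>i \<le> \<Phi>(e,e)q \<le> \<Phi>(D)q\<close> in the
  \<open>J\<close>-order; conversely, if \<open>H\<close> is a group with identity \<open>h\<close> and \<open>\<Phi>(e,e) = \<Phi>(D)\<close>, the inverse of
  \<open>h + \<Phi>(D)q\<close> in \<open>H\<close> is such an \<open>i\<close>. A tight twisting satisfies \<open>\<Phi>(a,b) = \<Phi>(a',b')\<close> for \<open>a L a'\<close>
  and \<open>b R b'\<close>, so it is constantly \<open>\<Phi>(e,e)\<close> on the \<open>H\<close>-class of \<open>e\<close>; hence
  \<open>(i, a) \<mapsto> (i + \<Phi>(e,e)q, a)\<close> untwists the product on a group \<open>H\<close>-class.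
\<close>

lemma quotient_eq_Image:
  assumes "equiv A r" and "K \<in> A // r" and "e \<in> K"
  shows "K = r `` {e}"
  using assms by (metis Image_singleton_iff equiv_class_eq quotientE)

section \<open>Green's relations in a monoid\<close>

context monoid
begin

section \<open>Principal ideals and Green's relations L, R, H, D\<close>

lemma r_coset_subset_iff:
  assumes "a \<in> carrier G" and "b \<in> carrier G"
  shows "carrier G #> a \<subseteq> carrier G #> b \<longleftrightarrow> (\<exists>x\<in>carrier G. a = x \<otimes> b)"
proof
  assume "carrier G #> a \<subseteq> carrier G #> b"
  \<comment> \<open>The identity puts \<open>a\<close> into its own principal left ideal; this turns
    inclusion of ideals into divisibility.\<close>
  moreover have "a \<in> carrier G #> a"
    using assms unfolding r_coset_def by (auto intro!: bexI[of _ \<one>])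
  ultimately show "\<exists>x\<in>carrier G. a = x \<otimes> b"
    unfolding r_coset_def by auto
next
  assume "\<exists>x\<in>carrier G. a = x \<otimes> b"
  then obtain x where x: "x \<in> carrier G" "a = x \<otimes> b" by auto
  show "carrier G #> a \<subseteq> carrier G #> b"
  proof
    fix y assume "y \<in> carrier G #> a"
    then obtain z where z: "z \<in> carrier G" "y = z \<otimes> a" unfolding r_coset_def by auto
    then have "y = (z \<otimes> x) \<otimes> b" using x assms by (simp add: m_assoc)
    then show "y \<in> carrier G #> b" unfolding r_coset_def using x z by auto
  qed
qed

lemma l_coset_subset_iff:
  assumes "a \<in> carrier G" and "b \<in> carrier G"
  shows "a <# carrier G \<subseteq> b <# carrier G \<longleftrightarrow> (\<exists>x\<in>carrier G. a = b \<otimes> x)"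
proof
  assume "a <# carrier G \<subseteq> b <# carrier G"
  moreover have "a \<in> a <# carrier G"
    using assms unfolding l_coset_def by (auto intro!: bexI[of _ \<one>])
  ultimately show "\<exists>x\<in>carrier G. a = b \<otimes> x"
    unfolding l_coset_def by auto
next
  assume "\<exists>x\<in>carrier G. a = b \<otimes> x"
  then obtain x where x: "x \<in> carrier G" "a = b \<otimes> x" by auto
  show "a <# carrier G \<subseteq> b <# carrier G"
  proof
    fix y assume "y \<in> a <# carrier G"
    then obtain z where z: "z \<in> carrier G" "y = a \<otimes> z" unfolding l_coset_def by auto
    then have "y = b \<otimes> (x \<otimes> z)" using x assms by (simp add: m_assoc)
    then show "y \<in> b <# carrier G" unfolding l_coset_def using x z by auto
  qed
qed

lemma green_L_iff:
  "(a, b) \<in> green_L G \<longleftrightarrow> a \<in> carrier G \<and> b \<in> carrier G \<and>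
    (\<exists>x\<in>carrier G. a = x \<otimes> b) \<and> (\<exists>x\<in>carrier G. b = x \<otimes> a)"
  unfolding green_L_def using r_coset_subset_iff by (auto simp: set_eq_subset)

lemma green_R_iff:
  "(a, b) \<in> green_R G \<longleftrightarrow> a \<in> carrier G \<and> b \<in> carrier G \<and>
    (\<exists>x\<in>carrier G. a = b \<otimes> x) \<and> (\<exists>x\<in>carrier G. b = a \<otimes> x)"
  unfolding green_R_def using l_coset_subset_iff by (auto simp: set_eq_subset)

lemma equiv_green_L: "equiv (carrier G) (green_L G)"
  unfolding green_L_def by (auto intro!: equivI refl_onI symI transI)

lemma equiv_green_R: "equiv (carrier G) (green_R G)"
  unfolding green_R_def by (auto intro!: equivI refl_onI symI transI)

lemma equiv_green_H: "equiv (carrier G) (green_H G)"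
  unfolding green_H_def green_L_def green_R_def
  by (auto intro!: equivI refl_onI symI transI)

text \<open>The classical square-completion argument: given \<open>a\<close> L \<open>c\<close> R
  \<open>b\<close>, the path through \<open>c\<close> can be replaced by one through the opposite
  corner of the square. It is what makes D a plain composite of L and R.\<close>

lemma green_LR_commute: "green_L G O green_R G = green_R G O green_L G"
proof -
  have sub: "green_L G O green_R G \<subseteq> green_R G O green_L G"
  proof (clarsimp)
    fix a b c
    assume "(a, c) \<in> green_L G" and "(c, b) \<in> green_R G"
    then obtain x y u v where
      car: "a \<in> carrier G" "b \<in> carrier G" "c \<in> carrier G"
        "x \<in> carrier G" "y \<in> carrier G" "u \<in> carrier G" "v \<in> carrier G"
      and eq: "c = x \<otimes> a" "a = y \<otimes> c" "c = b \<otimes> u" "b = c \<otimes> v"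
      unfolding green_L_iff green_R_iff by blast
    \<comment> \<open>The opposite corner is \<open>a v = y c v = y b\<close>: right multiplication
      by \<open>u\<close> undoes \<open>v\<close> and leads back to \<open>a\<close>, and left
      multiplication by \<open>x\<close> undoes \<open>y\<close> and leads to
      \<open>b\<close>.\<close>
    have av: "a \<otimes> v = y \<otimes> b" using car eq by (metis m_assoc)
    then have "a \<otimes> v \<otimes> u = a" using car eq by (metis m_assoc)
    then have "(a, a \<otimes> v) \<in> green_R G"
      unfolding green_R_iff using car by (metis m_closed)
    moreover have "x \<otimes> (a \<otimes> v) = b" using car eq by (metis m_assoc)
    then have "(a \<otimes> v, b) \<in> green_L G"
      unfolding green_L_iff using car av by (metis m_closed)
    ultimately show "(a, b) \<in> green_R G O green_L G" by auto
  qed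
  \<comment> \<open>L and R are symmetric, so taking converses in \<open>sub\<close> gives the other
    inclusion.\<close>
  have "(green_L G O green_R G)\<inverse> \<subseteq> (green_R G O green_L G)\<inverse>"
    using sub by (simp only: converse_mono)
  moreover have "(green_L G)\<inverse> = green_L G" "(green_R G)\<inverse> = green_R G"
    using equiv_green_L equiv_green_R by (auto simp: equiv_def sym_conv_converse_eq)
  ultimately have "green_R G O green_L G \<subseteq> green_L G O green_R G"
    by (simp add: converse_relcomp)
  with sub show ?thesis by auto
qed

lemma equiv_green_LR: "equiv (carrier G) (green_L G O green_R G)"
proof (rule equivI)
  let ?L = "green_L G" and ?R = "green_R G"
  have L: "refl_on (carrier G) ?L" "sym ?L" "trans ?L"
    using equiv_green_L by (auto simp: equiv_def)
  have R: "refl_on (carrier G) ?R" "sym ?R" "trans ?R"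
    using equiv_green_R by (auto simp: equiv_def)
  show "?L O ?R \<subseteq> carrier G \<times> carrier G" by (auto simp: green_L_def green_R_def)
  show "refl_on (carrier G) (?L O ?R)" using L(1) R(1) by (auto simp: refl_on_def)
  have "(?L O ?R)\<inverse> = ?L O ?R"
    using L(2) R(2) green_LR_commute by (simp add: converse_relcomp sym_conv_converse_eq)
  then show "sym (?L O ?R)" by (simp add: sym_conv_converse_eq)
  \<comment> \<open>Commuting the two inner factors brings equal relations together, and
    transitivity absorbs the repetition.\<close>
  have "(?L O ?R) O (?L O ?R) = (?L O ?L) O (?R O ?R)"
    by (metis O_assoc green_LR_commute)
  also have "\<dots> \<subseteq> ?L O ?R"
    using L(3) R(3) by (intro relcomp_mono) (simp_all add: trans_O_subset)
  finally show "trans (?L O ?R)" by (auto simp: trans_def)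
qed

text \<open>The composite is an equivalence, so it is the least one above L and R. The intersection
  defining D is thereby replaced by an explicit intermediate element.\<close>

lemma green_D_eq: "green_D G = green_L G O green_R G"
proof
  have "green_L G \<union> green_R G \<subseteq> green_L G O green_R G"
    by (auto simp: green_L_def green_R_def)
  then show "green_D G \<subseteq> green_L G O green_R G"
    unfolding green_D_def using equiv_green_LR by blast
  show "green_L G O green_R G \<subseteq> green_D G"
    unfolding green_D_def by (auto simp: equiv_def intro: transD)
qed

lemma equiv_green_D: "equiv (carrier G) (green_D G)"
  unfolding green_D_eq by (rule equiv_green_LR)

lemma green_L_le_D: "(a, b) \<in> green_L G \<Longrightarrow> (a, b) \<in> green_D G"
  unfolding green_D_def by auto

lemma green_H_le_D: "(a, b) \<in> green_H G \<Longrightarrow> (a, b) \<in> green_D G"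
  unfolding green_H_def by (auto intro: green_L_le_D)

section \<open>Regular elements, regular D-classes and idempotents\<close>

lemma regular_element_iff:
  "regular_element G a \<longleftrightarrow> (\<exists>x\<in>carrier G. a = a \<otimes> x \<otimes> a)"
  unfolding regular_element_def l_coset_def r_coset_def by auto

text \<open>With \<open>a = a x a\<close>, \<open>a = u b\<close> and \<open>b = v a\<close>, the
  witness for \<open>b\<close> is \<open>x u\<close>, because
  \<open>b x u b = v a x a = v a = b\<close>. The R-case is dual, with witness
  \<open>u x\<close>.\<close>

lemma regular_element_green_L:
  assumes "regular_element G a" and "(a, b) \<in> green_L G"
  shows "regular_element G b"
proof -
  obtain x u v where *: "a \<in> carrier G" "b \<in> carrier G" "x \<in> carrier G" "u \<in> carrier G"
      "v \<in> carrier G" "a = a \<otimes> x \<otimes> a" "a = u \<otimes> b" "b = v \<otimes> a"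
    using assms unfolding regular_element_iff green_L_iff by blast
  have "b = b \<otimes> (x \<otimes> u) \<otimes> b" using * by (metis m_assoc m_closed)
  with * show ?thesis unfolding regular_element_iff by blast
qed

lemma regular_element_green_R:
  assumes "regular_element G a" and "(a, b) \<in> green_R G"
  shows "regular_element G b"
proof -
  obtain x u v where *: "a \<in> carrier G" "b \<in> carrier G" "x \<in> carrier G" "u \<in> carrier G"
      "v \<in> carrier G" "a = a \<otimes> x \<otimes> a" "a = b \<otimes> u" "b = a \<otimes> v"
    using assms unfolding regular_element_iff green_R_iff by blast
  have "b = b \<otimes> (u \<otimes> x) \<otimes> b" using * by (metis m_assoc m_closed)
  with * show ?thesis unfolding regular_element_iff by blast
qed

text \<open>If \<open>a = a x a\<close>, then \<open>x a\<close> is an idempotent L-related to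
  \<open>a\<close>. Conversely an idempotent is regular with itself as witness, and regularity
  travels along L and R, hence through the whole D-class.\<close>

lemma regular_D_class_iff_idempotent:
  assumes D: "D \<in> carrier G // green_D G"
  shows "regular_D_class G D \<longleftrightarrow> (\<exists>e\<in>D. e \<otimes> e = e)"
proof
  assume reg: "regular_D_class G D"
  obtain a where a: "a \<in> D" using D equiv_green_D in_quotient_imp_non_empty by blast
  have aG: "a \<in> carrier G" using D a equiv_green_D in_quotient_imp_subset by blast
  obtain x where x: "x \<in> carrier G" "a = a \<otimes> x \<otimes> a"
    using reg a unfolding regular_D_class_def regular_element_iff by blast
  have "x \<otimes> a \<otimes> (x \<otimes> a) = x \<otimes> a" using x aG by (metis m_assoc m_closed)
  moreover have "(a, x \<otimes> a) \<in> green_L G"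
    unfolding green_L_iff using x aG by (metis m_assoc m_closed)
  then have "x \<otimes> a \<in> D"
    using quotient_eq_Image[OF equiv_green_D D a] green_L_le_D by auto
  ultimately show "\<exists>e\<in>D. e \<otimes> e = e" by auto
next
  assume "\<exists>e\<in>D. e \<otimes> e = e"
  then obtain e where e: "e \<in> D" "e \<otimes> e = e" by auto
  have eG: "e \<in> carrier G" using D e equiv_green_D in_quotient_imp_subset by blast
  have "regular_element G e" unfolding regular_element_iff using e eG by (metis m_closed)
  then have "regular_element G b" if "b \<in> D" for b
    using that quotient_eq_Image[OF equiv_green_D D e(1)] regular_element_green_L
      regular_element_green_R unfolding green_D_eq by blast
  then show "regular_D_class G D" unfolding regular_D_class_def using D by auto
qed

section \<open>Group H-classes as unit groups of the local monoids eGe\<close>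

lemma green_H_idempotent_iff:
  assumes e: "e \<in> carrier G" "e \<otimes> e = e"
  shows "(e, a) \<in> green_H G \<longleftrightarrow> a \<in> carrier G \<and> e \<otimes> a = a \<and> a \<otimes> e = a \<and>
    (\<exists>b\<in>carrier G. e \<otimes> b = b \<and> b \<otimes> e = b \<and> a \<otimes> b = e \<and> b \<otimes> a = e)"
proof
  assume "(e, a) \<in> green_H G"
  then have "(e, a) \<in> green_L G" "(e, a) \<in> green_R G" unfolding green_H_def by auto
  then obtain s t u v where *: "a \<in> carrier G" "s \<in> carrier G" "t \<in> carrier G"
      "u \<in> carrier G" "v \<in> carrier G" "a = e \<otimes> s" "a = t \<otimes> e" "e = a \<otimes> u" "e = v \<otimes> a"
    unfolding green_L_iff green_R_iff by blast
  have ea: "e \<otimes> a = a" "a \<otimes> e = a" using * e by (metis m_assoc)+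
  \<comment> \<open>One-sided inverses of \<open>a\<close> agree after cutting down to eGe:
    \<open>e u = v a u = v e\<close>. This common element is the two-sided inverse sought.\<close>
  have eu: "e \<otimes> u = v \<otimes> e" using * by (metis m_assoc)
  have "e \<otimes> (e \<otimes> u) = e \<otimes> u" using * e by (metis m_assoc)
  moreover have "e \<otimes> u \<otimes> e = e \<otimes> u" using * e eu by (metis m_assoc)
  moreover have "a \<otimes> (e \<otimes> u) = e" using * e ea by (metis m_assoc)
  moreover have "(e \<otimes> u) \<otimes> a = e" using * e ea eu by (metis m_assoc)
  ultimately show "a \<in> carrier G \<and> e \<otimes> a = a \<and> a \<otimes> e = a \<and>
    (\<exists>b\<in>carrier G. e \<otimes> b = b \<and> b \<otimes> e = b \<and> a \<otimes> b = e \<and> b \<otimes> a = e)"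
    using * e ea by (metis m_closed)
next
  assume "a \<in> carrier G \<and> e \<otimes> a = a \<and> a \<otimes> e = a \<and>
    (\<exists>b\<in>carrier G. e \<otimes> b = b \<and> b \<otimes> e = b \<and> a \<otimes> b = e \<and> b \<otimes> a = e)"
  then show "(e, a) \<in> green_H G"
    unfolding green_H_def Int_iff green_L_iff green_R_iff using e by metis
qed

text \<open>By the preceding characterization the members are exactly the units of eGe, so the group
  laws are those of a unit group, with identity \<open>e\<close> rather than the identity of
  \<open>G\<close>.\<close>

lemma group_green_H_class:
  assumes K: "K \<in> carrier G // green_H G" and e: "e \<in> K" "e \<otimes> e = e"
  shows "group (G\<lparr>carrier := K, one := e\<rparr>)"
proof -
  have sub: "K \<subseteq> carrier G" using K equiv_green_H in_quotient_imp_subset by blast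
  then have eG: "e \<in> carrier G" using e by auto
  have mem: "a \<in> K \<longleftrightarrow> a \<in> carrier G \<and> e \<otimes> a = a \<and> a \<otimes> e = a \<and>
      (\<exists>b\<in>carrier G. e \<otimes> b = b \<and> b \<otimes> e = b \<and> a \<otimes> b = e \<and> b \<otimes> a = e)" for a
    using quotient_eq_Image[OF equiv_green_H K e(1)] green_H_idempotent_iff[OF eG e(2)] by auto
  show ?thesis
  proof (rule groupI; simp)
    fix a b assume ab: "a \<in> K" "b \<in> K"
    then obtain a' b' where *: "a' \<in> carrier G" "b' \<in> carrier G"
        "e \<otimes> a' = a'" "a' \<otimes> e = a'" "a \<otimes> a' = e" "a' \<otimes> a = e"
        "e \<otimes> b' = b'" "b' \<otimes> e = b'" "b \<otimes> b' = e" "b' \<otimes> b = e"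
      unfolding mem by blast
    have abG: "a \<in> carrier G" "e \<otimes> a = a" "a \<otimes> e = a" "b \<in> carrier G" "e \<otimes> b = b" "b \<otimes> e = b"
      using ab mem by auto
    have "e \<otimes> (a \<otimes> b) = a \<otimes> b" "a \<otimes> b \<otimes> e = a \<otimes> b"
      using abG eG by (metis m_assoc)+
    moreover have "e \<otimes> (b' \<otimes> a') = b' \<otimes> a'" "b' \<otimes> a' \<otimes> e = b' \<otimes> a'"
      using * eG by (metis m_assoc)+
    moreover have "a \<otimes> b \<otimes> (b' \<otimes> a') = e" "b' \<otimes> a' \<otimes> (a \<otimes> b) = e"
      using * abG eG by (metis m_assoc m_closed)+
    ultimately show "a \<otimes> b \<in> K" unfolding mem using * abG by blast
  next
    show "e \<in> K" by (rule e)
  next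
    fix a b c assume "a \<in> K" "b \<in> K" "c \<in> K"
    then show "a \<otimes> b \<otimes> c = a \<otimes> (b \<otimes> c)" using sub by (auto intro: m_assoc)
  next
    fix a assume "a \<in> K"
    then show "e \<otimes> a = a" using mem by auto
  next
    fix a assume "a \<in> K"
    then obtain b where "a \<in> carrier G" "e \<otimes> a = a" "a \<otimes> e = a"
        "b \<in> carrier G" "e \<otimes> b = b" "b \<otimes> e = b" "a \<otimes> b = e" "b \<otimes> a = e"
      unfolding mem by blast
    then have "b \<in> K" "b \<otimes> a = e" using mem[of b] by auto
    then show "\<exists>b\<in>K. b \<otimes> a = e" by blast
  qed
qed

lemma is_group_in_green_H_class_iff:
  assumes "K \<in> carrier G // green_H G"
  shows "is_group_in G K \<longleftrightarrow> (\<exists>e\<in>K. e \<otimes> e = e)"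
proof
  assume "is_group_in G K"
  then obtain e where "group (G\<lparr>carrier := K, one := e\<rparr>)" unfolding is_group_in_def by auto
  then interpret K: group "G\<lparr>carrier := K, one := e\<rparr>" .
  show "\<exists>e\<in>K. e \<otimes> e = e" using K.one_closed K.l_one[OF K.one_closed] by auto
next
  assume "\<exists>e\<in>K. e \<otimes> e = e"
  then show "is_group_in G K" unfolding is_group_in_def using group_green_H_class assms by blast
qed

lemma group_H_class_idempotent:
  assumes "group_H_class G K"
  obtains e where "e \<in> carrier G" "e \<in> K" "e \<otimes> e = e" "K = green_H G `` {e}"
proof -
  have K: "K \<in> carrier G // green_H G" using assms unfolding group_H_class_def by simp
  with assms obtain e where e: "e \<in> K" "e \<otimes> e = e"
    using is_group_in_green_H_class_iff unfolding group_H_class_def by blast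
  moreover have "e \<in> carrier G" using in_quotient_imp_subset[OF equiv_green_H K] e by auto
  ultimately show ?thesis using that quotient_eq_Image[OF equiv_green_H K] by blast
qed

lemma group_H_class_Image:
  assumes "e \<in> carrier G" and "e \<otimes> e = e"
  shows "group_H_class G (green_H G `` {e})"
proof -
  have cl: "green_H G `` {e} \<in> carrier G // green_H G" using assms by (simp add: quotientI)
  moreover have "e \<in> green_H G `` {e}"
    using assms equiv_class_self[OF equiv_green_H] by simp
  ultimately show ?thesis
    unfolding group_H_class_def using is_group_in_green_H_class_iff[OF cl] assms by blast
qed

lemma green_H_Image_subset_D_class:
  assumes "D \<in> carrier G // green_D G" and "e \<in> D"
  shows "green_H G `` {e} \<subseteq> D"
  using quotient_eq_Image[OF equiv_green_D assms] green_H_le_D by auto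

text \<open>The H-class of any idempotent of \<open>D\<close> will do. This supplies the group
  H-class of S to which the isomorphism claim refers.\<close>

lemma regular_D_class_contains_group_H_class:
  assumes "regular_D_class G D"
  obtains K where "group_H_class G K" "K \<subseteq> D"
proof -
  have D: "D \<in> carrier G // green_D G" using assms unfolding regular_D_class_def by simp
  then obtain e where e: "e \<in> D" "e \<otimes> e = e"
    using assms regular_D_class_iff_idempotent by blast
  moreover have "e \<in> carrier G" using in_quotient_imp_subset[OF equiv_green_D D] e by auto
  ultimately show ?thesis
    using that group_H_class_Image green_H_Image_subset_D_class[OF D] by blast
qed

section \<open>Isomorphism of the group H-classes in one D-class\<close>

lemma idempotent_D_mutual_inverses:
  assumes e: "e \<in> carrier G" "e \<otimes> e = e" and f: "f \<in> carrier G" "f \<otimes> f = f"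
    and D: "(e, f) \<in> green_D G"
  obtains x y where "x \<in> carrier G" "y \<in> carrier G" "x \<otimes> y = e" "y \<otimes> x = f"
    "e \<otimes> x = x" "x \<otimes> f = x" "f \<otimes> y = y" "y \<otimes> e = y"
proof -
  \<comment> \<open>The intermediate element between \<open>e\<close> and \<open>f\<close> is taken
    in the order R, then L, so that \<open>x\<close> lies in eGf.\<close>
  obtain x where "(e, x) \<in> green_R G" "(x, f) \<in> green_L G"
    using D unfolding green_D_eq green_LR_commute by auto
  then obtain s t u v where *: "x \<in> carrier G" "s \<in> carrier G" "t \<in> carrier G"
      "u \<in> carrier G" "v \<in> carrier G" "x = e \<otimes> s" "x = t \<otimes> f" "e = x \<otimes> u" "f = v \<otimes> x"
    unfolding green_L_iff green_R_iff by blast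
  have x: "e \<otimes> x = x" "x \<otimes> f = x" using * e f by (metis m_assoc)+
  \<comment> \<open>The element \<open>u\<close> is a right inverse of \<open>x\<close> relative to
    \<open>e\<close>; multiplying by \<open>f\<close> on the left and \<open>e\<close> on the right
    moves it into fGe.\<close>
  let ?y = "f \<otimes> (u \<otimes> e)"
  note car = *(1-5) e(1) f(1)
  have "x \<otimes> ?y = (x \<otimes> f) \<otimes> u \<otimes> e" using car by (simp add: m_assoc)
  also have "\<dots> = e" using x(2) *(8) e(2) by simp
  finally have xy: "x \<otimes> ?y = e" .
  have "?y \<otimes> x = f \<otimes> (u \<otimes> (e \<otimes> x))" using car by (simp add: m_assoc)
  also have "\<dots> = v \<otimes> ((x \<otimes> u) \<otimes> x)" using x(1) *(9) car by (simp add: m_assoc)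
  also have "\<dots> = f" using *(8,9) x(1) by metis
  finally have yx: "?y \<otimes> x = f" .
  have "f \<otimes> ?y = ?y" using car f(2) by (simp add: m_assoc[symmetric])
  moreover have "?y \<otimes> e = ?y" using car e(2) by (simp add: m_assoc)
  moreover have "?y \<in> carrier G" using car by simp
  ultimately show ?thesis using that[of x ?y] car x xy yx by blast
qed

text \<open>Since the inner product \<open>x y = e\<close> is absorbed, conjugation is
  multiplicative from eGe to fGf. It therefore sends the inverse \<open>b\<close> of
  \<open>a\<close> to an inverse \<open>y b x\<close> of \<open>y a x\<close>.\<close>

lemma conjugate_in_green_H:
  assumes e: "e \<in> carrier G" "e \<otimes> e = e" and f: "f \<in> carrier G" "f \<otimes> f = f"
    and xy: "x \<in> carrier G" "y \<in> carrier G" "x \<otimes> y = e" "y \<otimes> x = f"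
      "e \<otimes> x = x" "x \<otimes> f = x" "f \<otimes> y = y" "y \<otimes> e = y"
    and a: "(e, a) \<in> green_H G"
  shows "(f, y \<otimes> (a \<otimes> x)) \<in> green_H G"
proof -
  obtain b where *: "a \<in> carrier G" "e \<otimes> a = a" "a \<otimes> e = a" "b \<in> carrier G"
      "e \<otimes> b = b" "b \<otimes> e = b" "a \<otimes> b = e" "b \<otimes> a = e"
    using a green_H_idempotent_iff[OF e] by auto
  have conj: "y \<otimes> (c \<otimes> x) \<otimes> (y \<otimes> (d \<otimes> x)) = y \<otimes> ((c \<otimes> d) \<otimes> x)"
    if "c \<in> carrier G" "d \<in> carrier G" "e \<otimes> d = d" for c d
    using that xy e by (metis m_assoc m_closed)
  have "f \<otimes> (y \<otimes> (c \<otimes> x)) = y \<otimes> (c \<otimes> x)" "y \<otimes> (c \<otimes> x) \<otimes> f = y \<otimes> (c \<otimes> x)"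
    if "c \<in> carrier G" for c
    using that xy f by (metis m_assoc m_closed)+
  moreover have "y \<otimes> (a \<otimes> x) \<otimes> (y \<otimes> (b \<otimes> x)) = f" "y \<otimes> (b \<otimes> x) \<otimes> (y \<otimes> (a \<otimes> x)) = f"
    using conj * xy by auto
  ultimately show ?thesis
    unfolding green_H_idempotent_iff[OF f] using * xy by (metis m_closed)
qed

lemma group_H_classes_iso:
  assumes K: "group_H_class G K" and L: "group_H_class G L"
    and D: "D \<in> carrier G // green_D G" "K \<subseteq> D" "L \<subseteq> D"
  shows "G \<restriction> K \<cong> G \<restriction> L"
proof -
  obtain e where e: "e \<in> carrier G" "e \<in> K" "e \<otimes> e = e" and Ke: "K = green_H G `` {e}"
    using group_H_class_idempotent[OF K] .
  obtain f where f: "f \<in> carrier G" "f \<in> L" "f \<otimes> f = f" and Lf: "L = green_H G `` {f}"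
    using group_H_class_idempotent[OF L] .
  have "(e, f) \<in> green_D G"
    using D e f quotient_eq_Image[OF equiv_green_D D(1)] by blast
  then obtain x y where xy: "x \<in> carrier G" "y \<in> carrier G" "x \<otimes> y = e" "y \<otimes> x = f"
    "e \<otimes> x = x" "x \<otimes> f = x" "f \<otimes> y = y" "y \<otimes> e = y"
    using idempotent_D_mutual_inverses e f by metis
  have Kmem: "a \<in> carrier G" "e \<otimes> a = a" "a \<otimes> e = a" if "a \<in> K" for a
    using that Ke green_H_idempotent_iff[OF e(1,3)] by auto
  have Lmem: "a \<in> carrier G" "f \<otimes> a = a" "a \<otimes> f = a" if "a \<in> L" for a
    using that Lf green_H_idempotent_iff[OF f(1,3)] by auto
  let ?g = "\<lambda>a. y \<otimes> (a \<otimes> x)" and ?h = "\<lambda>a. x \<otimes> (a \<otimes> y)"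
  have gL: "?g a \<in> L" if "a \<in> K" for a
    using that conjugate_in_green_H[OF e(1,3) f(1,3) xy] Ke Lf by auto
  \<comment> \<open>The facts \<open>xy\<close> are symmetric under exchanging \<open>e\<close> with
    \<open>f\<close> and \<open>x\<close> with \<open>y\<close>; in permuted order they yield
    conjugation in the other direction.\<close>
  have hK: "?h a \<in> K" if "a \<in> L" for a
    using that conjugate_in_green_H[OF f(1,3) e(1,3) xy(2,1,4,3,7,8,5,6)] Ke Lf by auto
  have "?h (?g a) = a" if "a \<in> K" for a
    using Kmem[OF that] xy e by (metis m_assoc m_closed)
  moreover have "?g (?h a) = a" if "a \<in> L" for a
    using Lmem[OF that] xy f by (metis m_assoc m_closed)
  ultimately have "bij_betw ?g K L"
    using gL hK by (intro bij_betw_byWitness[where f' = ?h]) auto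
  moreover have "?g (a \<otimes> b) = ?g a \<otimes> ?g b" if "a \<in> K" "b \<in> K" for a b
    using Kmem[OF that(1)] Kmem[OF that(2)] xy e by (metis m_assoc m_closed)
  ultimately have "?g \<in> iso (G \<restriction> K) (G \<restriction> L)"
    using gL unfolding iso_def hom_def by auto
  then show ?thesis unfolding is_iso_def by auto
qed

end

context comm_monoid
begin

section \<open>Commutative monoids: the J-order and translates of group H-classes\<close>

lemma green_J_le_iff:
  assumes "a \<in> carrier G" and "b \<in> carrier G"
  shows "green_J_le G a b \<longleftrightarrow> (\<exists>l\<in>carrier G. a = b \<otimes> l)"
proof -
  \<comment> \<open>By commutativity the two-sided principal ideal collapses to the one-sided
    one.\<close>
  have eq: "(carrier G #> c) <#> carrier G = carrier G #> c" if "c \<in> carrier G" for c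
  proof
    show "(carrier G #> c) <#> carrier G \<subseteq> carrier G #> c"
    proof
      fix y assume "y \<in> (carrier G #> c) <#> carrier G"
      then obtain u v where "u \<in> carrier G" "v \<in> carrier G" "y = u \<otimes> c \<otimes> v"
        unfolding r_coset_def set_mult_def by auto
      then have "y = (u \<otimes> v) \<otimes> c" "u \<otimes> v \<in> carrier G" using that by (auto simp: m_ac)
      then show "y \<in> carrier G #> c" unfolding r_coset_def by auto
    qed
    show "carrier G #> c \<subseteq> (carrier G #> c) <#> carrier G"
    proof
      fix y assume y: "y \<in> carrier G #> c"
      then have "y \<otimes> \<one> = y" using that unfolding r_coset_def by auto
      then show "y \<in> (carrier G #> c) <#> carrier G"
        using y one_closed unfolding set_mult_def by (metis (no_types) UN_iff singletonI)
    qed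
  qed
  have "(\<exists>x\<in>carrier G. a = x \<otimes> b) \<longleftrightarrow> (\<exists>x\<in>carrier G. a = b \<otimes> x)"
    using assms(2) m_comm by auto
  then show ?thesis
    unfolding green_J_le_def eq[OF assms(1)] eq[OF assms(2)] r_coset_subset_iff[OF assms] .
qed

lemma green_H_iff:
  "(a, b) \<in> green_H G \<longleftrightarrow> a \<in> carrier G \<and> b \<in> carrier G \<and>
    (\<exists>x\<in>carrier G. a = b \<otimes> x) \<and> (\<exists>x\<in>carrier G. b = a \<otimes> x)"
proof -
  have "(\<exists>x\<in>carrier G. c = x \<otimes> d) \<longleftrightarrow> (\<exists>x\<in>carrier G. c = d \<otimes> x)" if "d \<in> carrier G" for c d
    using that m_comm by auto
  then show ?thesis unfolding green_H_def Int_iff green_L_iff green_R_iff by blast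
qed

lemma green_J_le_cong:
  assumes "(i, j) \<in> green_H G" and "k \<in> carrier G"
  shows "green_J_le G i k \<longleftrightarrow> green_J_le G j k"
proof -
  have "green_J_le G b k" if ab: "(a, b) \<in> green_H G" and le: "green_J_le G a k" for a b
  proof -
    obtain x where x: "a \<in> carrier G" "b \<in> carrier G" "x \<in> carrier G" "b = a \<otimes> x"
      using ab unfolding green_H_iff by blast
    then obtain l where l: "l \<in> carrier G" "a = k \<otimes> l"
      using le green_J_le_iff[OF _ assms(2)] by blast
    have "b = k \<otimes> (l \<otimes> x)" using x(3,4) l assms(2) by (simp add: m_assoc)
    then show ?thesis using green_J_le_iff[OF x(2) assms(2)] l(1) x(3) by blast
  qed
  moreover have "(j, i) \<in> green_H G" using assms unfolding green_H_iff by blast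
  ultimately show ?thesis using assms by blast
qed

text \<open>H-related elements are multiples of one another, so they lie below the same elements.
  Both quantifiers thus reduce to one representative, which is the "some (equivalently all)" of the
  theorem.\<close>

lemma green_J_le_class:
  assumes "H \<in> carrier G // green_H G" and "i \<in> H" and "k \<in> carrier G"
  shows "(\<exists>j\<in>H. green_J_le G j k) \<longleftrightarrow> green_J_le G i k"
    and "(\<forall>j\<in>H. green_J_le G j k) \<longleftrightarrow> green_J_le G i k"
proof -
  have "green_J_le G j k \<longleftrightarrow> green_J_le G i k" if "j \<in> H" for j
    using that quotient_eq_Image[OF equiv_green_H assms(1,2)] green_J_le_cong[OF _ assms(3)] by auto
  with assms(2) show "(\<exists>j\<in>H. green_J_le G j k) \<longleftrightarrow> green_J_le G i k"
    and "(\<forall>j\<in>H. green_J_le G j k) \<longleftrightarrow> green_J_le G i k"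
    by blast+
qed

text \<open>Commutativity lets any \<open>b\<close> with \<open>a b = e\<close> serve as witness:
  together with \<open>e a = a\<close> it makes \<open>e\<close> and \<open>a\<close> divide each
  other.\<close>

lemma green_H_idempotent_comm_iff:
  assumes "e \<in> carrier G" and "e \<otimes> e = e"
  shows "(e, a) \<in> green_H G \<longleftrightarrow> a \<in> carrier G \<and> e \<otimes> a = a \<and> (\<exists>b\<in>carrier G. a \<otimes> b = e)"
proof
  assume "(e, a) \<in> green_H G"
  then show "a \<in> carrier G \<and> e \<otimes> a = a \<and> (\<exists>b\<in>carrier G. a \<otimes> b = e)"
    using green_H_idempotent_iff[OF assms] by blast
next
  assume a: "a \<in> carrier G \<and> e \<otimes> a = a \<and> (\<exists>b\<in>carrier G. a \<otimes> b = e)"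
  then have "a = e \<otimes> a" "\<exists>b\<in>carrier G. e = a \<otimes> b" by auto
  then show "(e, a) \<in> green_H G" unfolding green_H_iff using a assms by blast
qed

text \<open>An inverse of \<open>e k\<close> exhibits \<open>e\<close> as a multiple of
  \<open>k\<close>; conversely \<open>e = k l\<close> gives \<open>e k l = e e = e\<close>, so
  \<open>e k\<close> is invertible relative to \<open>e\<close>.\<close>

lemma mem_group_class_iff_J_le:
  assumes "e \<in> carrier G" and "e \<otimes> e = e" and "k \<in> carrier G"
  shows "(e, e \<otimes> k) \<in> green_H G \<longleftrightarrow> green_J_le G e k"
proof
  assume "(e, e \<otimes> k) \<in> green_H G"
  then obtain b where "b \<in> carrier G" "e \<otimes> k \<otimes> b = e"
    using green_H_idempotent_comm_iff[OF assms(1,2)] by blast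
  then have "e = k \<otimes> (e \<otimes> b)" using assms by (simp add: m_ac)
  then show "green_J_le G e k" using assms \<open>b \<in> carrier G\<close> green_J_le_iff by (metis m_closed)
next
  assume "green_J_le G e k"
  then obtain l where l: "l \<in> carrier G" "e = k \<otimes> l"
    using green_J_le_iff[OF assms(1,3)] by auto
  then have "e \<otimes> k \<otimes> l = e" using assms by (simp add: m_assoc)
  moreover have "e \<otimes> (e \<otimes> k) = e \<otimes> k" using assms by (simp add: m_assoc[symmetric])
  ultimately show "(e, e \<otimes> k) \<in> green_H G"
    using l assms green_H_idempotent_comm_iff by blast
qed

text \<open>On \<open>H\<close> translation by \<open>k\<close> is translation by the group element
  \<open>e k\<close>, and it is undone by the inverse \<open>l\<close> of that element.\<close>

lemma bij_betw_translate:
  assumes e: "e \<in> carrier G" "e \<otimes> e = e" and H: "H = green_H G `` {e}"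
    and k: "k \<in> carrier G" "green_J_le G e k"
  shows "bij_betw (\<lambda>i. i \<otimes> k) H H"
proof -
  have "(e, e \<otimes> k) \<in> green_H G" using mem_group_class_iff_J_le e k by blast
  then obtain l where l: "l \<in> carrier G" "e \<otimes> l = l" "e \<otimes> k \<otimes> l = e"
    using green_H_idempotent_iff[OF e] by blast
  have mem: "a \<in> H \<longleftrightarrow> a \<in> carrier G \<and> e \<otimes> a = a \<and> (\<exists>b\<in>carrier G. a \<otimes> b = e)" for a
    unfolding H using green_H_idempotent_comm_iff[OF e] by auto
  have kl: "k \<otimes> l = e" using l e k by (metis m_comm m_assoc)
  have inv: "a \<otimes> k \<otimes> l = a" "a \<otimes> l \<otimes> k = a" if "a \<in> H" for a
    using that kl l(1) k(1) e unfolding mem by (metis m_comm m_assoc)+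
  \<comment> \<open>Stated for any \<open>c\<close> invertible relative to \<open>e\<close>, so that
    it covers translation by \<open>k\<close> and by \<open>l\<close> alike.\<close>
  have closed: "a \<otimes> c \<in> H" if a: "a \<in> H" and c: "c \<in> carrier G" "d \<in> carrier G" "c \<otimes> d = e" for a c d
  proof -
    obtain b where b: "a \<in> carrier G" "e \<otimes> a = a" "b \<in> carrier G" "a \<otimes> b = e"
      using a mem by blast
    have "a \<otimes> c \<otimes> (b \<otimes> d) = (a \<otimes> b) \<otimes> (c \<otimes> d)" using b(1,3) c(1,2) by (simp add: m_ac)
    then have "a \<otimes> c \<otimes> (b \<otimes> d) = e" using b c e by simp
    moreover have "e \<otimes> (a \<otimes> c) = a \<otimes> c" using b(1,2) c(1) e(1) by (simp add: m_assoc[symmetric])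
    ultimately show ?thesis unfolding mem using b c by blast
  qed
  have "l \<otimes> k = e" using kl l(1) k(1) m_comm by simp
  then show ?thesis
    using closed kl l(1) k(1) inv by (intro bij_betw_byWitness[where f' = "\<lambda>i. i \<otimes> l"]) auto
qed

text \<open>If \<open>H\<close> equals its translate, then \<open>e\<close> itself has the form
  \<open>h k\<close> and is a multiple of \<open>k\<close>; the converse is surjectivity of the
  translation.\<close>

lemma translate_eq_iff_J_le:
  assumes e: "e \<in> carrier G" "e \<otimes> e = e" and H: "H = green_H G `` {e}" and k: "k \<in> carrier G"
  shows "H = H #> k \<longleftrightarrow> green_J_le G e k"
proof
  assume "H = H #> k"
  moreover have "e \<in> H" unfolding H using green_H_idempotent_comm_iff[OF e] e by blast
  ultimately obtain h where "h \<in> H" "e = h \<otimes> k" unfolding r_coset_def by blast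
  moreover from this have "h \<in> carrier G" unfolding H by (auto simp: green_H_iff)
  ultimately show "green_J_le G e k" using green_J_le_iff[OF e(1) k] m_comm[OF _ k] by auto
next
  assume "green_J_le G e k"
  then have "(\<lambda>i. i \<otimes> k) ` H = H" using bij_betw_translate[OF e H k] by (simp add: bij_betw_def)
  then show "H = H #> k" unfolding r_coset_def by auto
qed

text \<open>The power 0 is the identity, above everything. A positive power is a multiple of
  \<open>k\<close>, and idempotency of \<open>e\<close> allows \<open>e = k l\<close> to be raised
  to any power. This links conditions (iii) and (iv).\<close>

lemma idempotent_J_le_pow_iff:
  assumes e: "e \<in> carrier G" "e \<otimes> e = e" and k: "k \<in> carrier G"
  shows "green_J_le G e (k [^] (n::nat)) \<longleftrightarrow> n = 0 \<or> green_J_le G e k"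
proof (cases n)
  case 0
  then show ?thesis using e green_J_le_iff[OF e(1) one_closed] by auto
next
  case (Suc m)
  have "green_J_le G e (k [^] Suc m)" if le: "green_J_le G e k"
  proof -
    obtain l where l: "l \<in> carrier G" "e = k \<otimes> l" using le green_J_le_iff[OF e(1) k] by auto
    \<comment> \<open>The trailing factor \<open>e\<close> makes the claim true at
      \<open>r = 0\<close>; each induction step adds \<open>k l = e\<close>, absorbed by
      idempotency.\<close>
    have "k [^] r \<otimes> (l [^] r \<otimes> e) = e" for r :: nat
    proof (induction r)
      case (Suc r)
      have "k [^] Suc r \<otimes> (l [^] Suc r \<otimes> e) = (k [^] r \<otimes> (l [^] r \<otimes> e)) \<otimes> (k \<otimes> l)"
        using k l(1) e(1) by (simp add: m_ac)
      also have "\<dots> = e \<otimes> e" unfolding Suc l(2)[symmetric] ..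
      finally show ?case using e(2) by simp
    qed (use e in simp)
    then have "e = k [^] Suc m \<otimes> (l [^] Suc m \<otimes> e)" by metis
    moreover have "l [^] Suc m \<otimes> e \<in> carrier G" using l(1) e(1) by simp
    ultimately show ?thesis using green_J_le_iff[OF e(1) nat_pow_closed[OF k, of "Suc m"]] by blast
  qed
  moreover have "green_J_le G e k" if le: "green_J_le G e (k [^] Suc m)"
  proof -
    obtain l where l: "l \<in> carrier G" "e = k [^] Suc m \<otimes> l"
      using le unfolding green_J_le_iff[OF e(1) nat_pow_closed[OF k]] by (elim bexE)
    have "k [^] Suc m \<otimes> l = k \<otimes> (k [^] m \<otimes> l)"
      unfolding nat_pow_Suc2[OF k] using k l(1) by (intro m_assoc) simp_all
    then have "e = k \<otimes> (k [^] m \<otimes> l)" using l(2) by simp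
    moreover have "k [^] m \<otimes> l \<in> carrier G" using l(1) k by simp
    ultimately show ?thesis using green_J_le_iff[OF e(1) k] by blast
  qed
  ultimately show ?thesis using Suc by auto
qed

end

section \<open>Tight twisted products\<close>

locale tight_twisted_product = M: comm_monoid M + S: monoid S
  for M :: "('m, 'x) monoid_scheme" and S :: "('s, 'y) monoid_scheme" +
  fixes q :: 'm and \<Phi> :: "'s \<Rightarrow> 's \<Rightarrow> nat"
  assumes q_closed [simp]: "q \<in> carrier M"
    and tight: "tight_twisting S \<Phi>"
begin

section \<open>The twisted product as a monoid\<close>

abbreviation T where "T \<equiv> twisted_product M q \<Phi> S"

lemma carrier_T [simp]: "carrier T = carrier M \<times> carrier S"
  by (simp add: twisted_product_def)

lemma mult_T [simp]:
  "(i, a) \<otimes>\<^bsub>T\<^esub> (j, b) = (i \<otimes>\<^bsub>M\<^esub> j \<otimes>\<^bsub>M\<^esub> q [^]\<^bsub>M\<^esub> \<Phi> a b, a \<otimes>\<^bsub>S\<^esub> b)"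
  by (simp add: twisted_product_def)

lemma cocycle:
  assumes "a \<in> carrier S" and "b \<in> carrier S" and "c \<in> carrier S"
  shows "\<Phi> a b + \<Phi> (a \<otimes>\<^bsub>S\<^esub> b) c = \<Phi> a (b \<otimes>\<^bsub>S\<^esub> c) + \<Phi> b c"
proof -
  have "twisting S \<Phi>" using tight unfolding tight_twisting_def by simp
  then show ?thesis using assms unfolding twisting_def by simp
qed

lemma tight_left:
  assumes "a \<in> carrier S" and "b \<in> carrier S"
  obtains a' where "a' \<in> carrier S" "a \<otimes>\<^bsub>S\<^esub> b = a' \<otimes>\<^bsub>S\<^esub> b" "\<Phi> a' b = 0"
  using tight assms unfolding tight_twisting_def by blast

lemma tight_right:
  assumes "a \<in> carrier S" and "b \<in> carrier S"
  obtains b' where "b' \<in> carrier S" "a \<otimes>\<^bsub>S\<^esub> b = a \<otimes>\<^bsub>S\<^esub> b'" "\<Phi> a b' = 0"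
  using tight assms unfolding tight_twisting_def by blast

text \<open>Tightness at the pair of identities gives a left factor \<open>a\<close> with
  \<open>a 1 = 1\<close>, which forces \<open>a = 1\<close>.\<close>

lemma twist_one_one: "\<Phi> \<one>\<^bsub>S\<^esub> \<one>\<^bsub>S\<^esub> = 0"
proof -
  obtain a where "a \<in> carrier S" "\<one>\<^bsub>S\<^esub> \<otimes>\<^bsub>S\<^esub> \<one>\<^bsub>S\<^esub> = a \<otimes>\<^bsub>S\<^esub> \<one>\<^bsub>S\<^esub>" "\<Phi> a \<one>\<^bsub>S\<^esub> = 0"
    using tight_left[OF S.one_closed S.one_closed] .
  then show ?thesis by simp
qed

text \<open>The cocycle identity at \<open>(1, 1, a)\<close> and at \<open>(a, 1, 1)\<close> cancels
  down to the value at \<open>(1, 1)\<close>.\<close>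

lemma twist_one:
  assumes "a \<in> carrier S"
  shows "\<Phi> \<one>\<^bsub>S\<^esub> a = 0" and "\<Phi> a \<one>\<^bsub>S\<^esub> = 0"
  using cocycle[of "\<one>\<^bsub>S\<^esub>" "\<one>\<^bsub>S\<^esub>" a] cocycle[of a "\<one>\<^bsub>S\<^esub>" "\<one>\<^bsub>S\<^esub>"] assms twist_one_one by auto

lemma monoid_T: "monoid T"
proof
  fix x y z assume "x \<in> carrier T" "y \<in> carrier T" "z \<in> carrier T"
  then obtain i a j b k c where [simp]: "x = (i, a)" "y = (j, b)" "z = (k, c)"
      "i \<in> carrier M" "j \<in> carrier M" "k \<in> carrier M"
      "a \<in> carrier S" "b \<in> carrier S" "c \<in> carrier S"
    by auto
  \<comment> \<open>The cocycle identity says that both bracketings collect the same multiple of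
    \<open>q\<close>; the rest of associativity is rearrangement in \<open>M\<close>.\<close>
  have "q [^]\<^bsub>M\<^esub> \<Phi> a b \<otimes>\<^bsub>M\<^esub> q [^]\<^bsub>M\<^esub> \<Phi> (a \<otimes>\<^bsub>S\<^esub> b) c =
      q [^]\<^bsub>M\<^esub> \<Phi> a (b \<otimes>\<^bsub>S\<^esub> c) \<otimes>\<^bsub>M\<^esub> q [^]\<^bsub>M\<^esub> \<Phi> b c"
    by (simp add: M.nat_pow_mult cocycle)
  moreover have "i \<otimes>\<^bsub>M\<^esub> j \<otimes>\<^bsub>M\<^esub> u \<otimes>\<^bsub>M\<^esub> k \<otimes>\<^bsub>M\<^esub> v = i \<otimes>\<^bsub>M\<^esub> j \<otimes>\<^bsub>M\<^esub> k \<otimes>\<^bsub>M\<^esub> (u \<otimes>\<^bsub>M\<^esub> v)"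
    "i \<otimes>\<^bsub>M\<^esub> (j \<otimes>\<^bsub>M\<^esub> k \<otimes>\<^bsub>M\<^esub> u) \<otimes>\<^bsub>M\<^esub> v = i \<otimes>\<^bsub>M\<^esub> j \<otimes>\<^bsub>M\<^esub> k \<otimes>\<^bsub>M\<^esub> (v \<otimes>\<^bsub>M\<^esub> u)"
    if "u \<in> carrier M" "v \<in> carrier M" for u v
    using that by (simp_all add: M.m_ac)
  ultimately show "x \<otimes>\<^bsub>T\<^esub> y \<otimes>\<^bsub>T\<^esub> z = x \<otimes>\<^bsub>T\<^esub> (y \<otimes>\<^bsub>T\<^esub> z)"
    by (simp add: S.m_assoc)
qed (auto simp: twisted_product_def twist_one)

sublocale T: monoid T
  by (rule monoid_T)

section \<open>Green's relations of the twisted product\<close>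

lemma green_L_T_iff:
  "((i, a), (j, b)) \<in> green_L T \<longleftrightarrow> (i, j) \<in> green_H M \<and> (a, b) \<in> green_L S"
proof -
  \<comment> \<open>Divisibility in \<open>T\<close> is componentwise. The variables are generalized
    because the claim is applied in both directions.\<close>
  have "(\<exists>x\<in>carrier T. (i, a) = x \<otimes>\<^bsub>T\<^esub> (j, b)) \<longleftrightarrow>
      (\<exists>k\<in>carrier M. i = j \<otimes>\<^bsub>M\<^esub> k) \<and> (\<exists>c\<in>carrier S. a = c \<otimes>\<^bsub>S\<^esub> b)"
    if jb: "j \<in> carrier M" "b \<in> carrier S" for i j a b
  proof
    assume "\<exists>x\<in>carrier T. (i, a) = x \<otimes>\<^bsub>T\<^esub> (j, b)"
    then obtain k c where *: "k \<in> carrier M" "c \<in> carrier S"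
        "i = k \<otimes>\<^bsub>M\<^esub> j \<otimes>\<^bsub>M\<^esub> q [^]\<^bsub>M\<^esub> \<Phi> c b" "a = c \<otimes>\<^bsub>S\<^esub> b"
      by auto
    \<comment> \<open>The multiple of \<open>q\<close> produced by the twist is absorbed into the
      cofactor in \<open>M\<close>.\<close>
    then have "i = j \<otimes>\<^bsub>M\<^esub> (k \<otimes>\<^bsub>M\<^esub> q [^]\<^bsub>M\<^esub> \<Phi> c b)" using that by (simp add: M.m_ac)
    then show "(\<exists>k\<in>carrier M. i = j \<otimes>\<^bsub>M\<^esub> k) \<and> (\<exists>c\<in>carrier S. a = c \<otimes>\<^bsub>S\<^esub> b)"
      using * by (metis M.m_closed M.nat_pow_closed q_closed)
  next
    assume "(\<exists>k\<in>carrier M. i = j \<otimes>\<^bsub>M\<^esub> k) \<and> (\<exists>c\<in>carrier S. a = c \<otimes>\<^bsub>S\<^esub> b)"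
    then obtain k c where k: "k \<in> carrier M" "i = j \<otimes>\<^bsub>M\<^esub> k" and c: "c \<in> carrier S" "a = c \<otimes>\<^bsub>S\<^esub> b"
      by auto
    \<comment> \<open>Tightness exchanges \<open>c\<close> for a factor \<open>d\<close> with the
      same product and no twist, so the components can be prescribed independently.\<close>
    obtain d where d: "d \<in> carrier S" "c \<otimes>\<^bsub>S\<^esub> b = d \<otimes>\<^bsub>S\<^esub> b" "\<Phi> d b = 0"
      using tight_left[OF c(1) jb(2)] .
    have "(i, a) = (k, d) \<otimes>\<^bsub>T\<^esub> (j, b)"
      using k(1) that d(1,3) unfolding k(2) c(2) d(2) by (simp add: M.m_comm)
    moreover have "(k, d) \<in> carrier T" using k(1) d(1) by simp
    ultimately show "\<exists>x\<in>carrier T. (i, a) = x \<otimes>\<^bsub>T\<^esub> (j, b)" by blast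
  qed
  note eq = this
  have "(i, a) \<in> carrier T \<longleftrightarrow> i \<in> carrier M \<and> a \<in> carrier S"
    "(j, b) \<in> carrier T \<longleftrightarrow> j \<in> carrier M \<and> b \<in> carrier S" by simp_all
  then show ?thesis
    unfolding T.green_L_iff S.green_L_iff M.green_H_iff using eq[of j b i a] eq[of i a j b] by satx
qed

text \<open>The mirror image, with the other half of tightness removing the twist.\<close>

lemma green_R_T_iff:
  "((i, a), (j, b)) \<in> green_R T \<longleftrightarrow> (i, j) \<in> green_H M \<and> (a, b) \<in> green_R S"
proof -
  have "(\<exists>x\<in>carrier T. (i, a) = (j, b) \<otimes>\<^bsub>T\<^esub> x) \<longleftrightarrow>
      (\<exists>k\<in>carrier M. i = j \<otimes>\<^bsub>M\<^esub> k) \<and> (\<exists>c\<in>carrier S. a = b \<otimes>\<^bsub>S\<^esub> c)"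
    if jb: "j \<in> carrier M" "b \<in> carrier S" for i j a b
  proof
    assume "\<exists>x\<in>carrier T. (i, a) = (j, b) \<otimes>\<^bsub>T\<^esub> x"
    then obtain k c where *: "k \<in> carrier M" "c \<in> carrier S"
        "i = j \<otimes>\<^bsub>M\<^esub> k \<otimes>\<^bsub>M\<^esub> q [^]\<^bsub>M\<^esub> \<Phi> b c" "a = b \<otimes>\<^bsub>S\<^esub> c"
      by auto
    then have "i = j \<otimes>\<^bsub>M\<^esub> (k \<otimes>\<^bsub>M\<^esub> q [^]\<^bsub>M\<^esub> \<Phi> b c)" using that by (simp add: M.m_assoc)
    then show "(\<exists>k\<in>carrier M. i = j \<otimes>\<^bsub>M\<^esub> k) \<and> (\<exists>c\<in>carrier S. a = b \<otimes>\<^bsub>S\<^esub> c)"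
      using * by (metis M.m_closed M.nat_pow_closed q_closed)
  next
    assume "(\<exists>k\<in>carrier M. i = j \<otimes>\<^bsub>M\<^esub> k) \<and> (\<exists>c\<in>carrier S. a = b \<otimes>\<^bsub>S\<^esub> c)"
    then obtain k c where k: "k \<in> carrier M" "i = j \<otimes>\<^bsub>M\<^esub> k" and c: "c \<in> carrier S" "a = b \<otimes>\<^bsub>S\<^esub> c"
      by auto
    obtain d where d: "d \<in> carrier S" "b \<otimes>\<^bsub>S\<^esub> c = b \<otimes>\<^bsub>S\<^esub> d" "\<Phi> b d = 0"
      using tight_right[OF jb(2) c(1)] .
    have "(i, a) = (j, b) \<otimes>\<^bsub>T\<^esub> (k, d)"
      using k(1) that d(1,3) unfolding k(2) c(2) d(2) by simp
    moreover have "(k, d) \<in> carrier T" using k(1) d(1) by simp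
    ultimately show "\<exists>x\<in>carrier T. (i, a) = (j, b) \<otimes>\<^bsub>T\<^esub> x" by blast
  qed
  note eq = this
  have "(i, a) \<in> carrier T \<longleftrightarrow> i \<in> carrier M \<and> a \<in> carrier S"
    "(j, b) \<in> carrier T \<longleftrightarrow> j \<in> carrier M \<and> b \<in> carrier S" by simp_all
  then show ?thesis
    unfolding T.green_R_iff S.green_R_iff M.green_H_iff using eq[of j b i a] eq[of i a j b] by satx
qed

lemma green_H_T_iff:
  "((i, a), (j, b)) \<in> green_H T \<longleftrightarrow> (i, j) \<in> green_H M \<and> (a, b) \<in> green_H S"
  unfolding green_H_def[of T] green_H_def[of S] Int_iff green_L_T_iff green_R_T_iff by satx

text \<open>L and R of \<open>T\<close> both induce H on the \<open>M\<close>-component. Their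
  composite induces H again: transitivity eliminates an intermediate value, and conversely
  \<open>i\<close> itself can serve as one.\<close>

lemma green_D_T_iff:
  "((i, a), (j, b)) \<in> green_D T \<longleftrightarrow> (i, j) \<in> green_H M \<and> (a, b) \<in> green_D S"
proof -
  have M: "sym (green_H M)" "trans (green_H M)" using M.equiv_green_H by (auto simp: equiv_def)
  have "(i, i) \<in> green_H M" if "(i, j) \<in> green_H M"
    using M that by (meson symD transD)
  moreover have "(i, j) \<in> green_H M" if "(i, k) \<in> green_H M" "(k, j) \<in> green_H M" for k
    using M that by (meson transD)
  ultimately show ?thesis
    unfolding T.green_D_eq S.green_D_eq relcomp_unfold
    by (auto simp: green_L_T_iff green_R_T_iff)
qed

lemma product_D_class:
  assumes "H \<in> carrier M // green_H M" and "D \<in> carrier S // green_D S"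
  shows "H \<times> D \<in> carrier T // green_D T"
proof -
  obtain i a where "i \<in> carrier M" "a \<in> carrier S" "H = green_H M `` {i}" "D = green_D S `` {a}"
    using assms by (auto elim!: quotientE)
  moreover from this have "H \<times> D = green_D T `` {(i, a)}"
    by (auto simp: green_D_T_iff)
  ultimately show ?thesis by (auto intro: quotientI)
qed

section \<open>Monotonicity and invariance of the twisting\<close>

lemma twist_left_le:
  assumes "a \<in> carrier S" "b \<in> carrier S" "s \<in> carrier S" "a' = s \<otimes>\<^bsub>S\<^esub> a"
  shows "\<Phi> a b \<le> \<Phi> a' b"
proof -
  \<comment> \<open>With \<open>\<Phi> t a = 0\<close> the cocycle identity at
    \<open>(t, a, b)\<close> reads \<open>\<Phi> a' b = \<Phi> t (a b) + \<Phi> a b\<close>.\<close>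
  obtain t where "t \<in> carrier S" "a' = t \<otimes>\<^bsub>S\<^esub> a" "\<Phi> t a = 0"
    using tight_left[OF assms(3,1)] assms(4) by metis
  then show ?thesis using cocycle[of t a b] assms by auto
qed

lemma twist_right_le:
  assumes "a \<in> carrier S" "b \<in> carrier S" "s \<in> carrier S" "b' = b \<otimes>\<^bsub>S\<^esub> s"
  shows "\<Phi> a b \<le> \<Phi> a b'"
proof -
  obtain t where "t \<in> carrier S" "b' = b \<otimes>\<^bsub>S\<^esub> t" "\<Phi> b t = 0"
    using tight_right[OF assms(2,3)] assms(4) by metis
  then show ?thesis using cocycle[of a b t] assms by auto
qed

text \<open>Related elements divide each other on the appropriate side, so the monotonicity bounds
  hold in both directions.\<close>

lemma twist_eq:
  assumes "(a, a') \<in> green_L S" and "(b, b') \<in> green_R S"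
  shows "\<Phi> a b = \<Phi> a' b'"
proof -
  obtain s t u v where *: "a \<in> carrier S" "a' \<in> carrier S" "b \<in> carrier S" "b' \<in> carrier S"
      "s \<in> carrier S" "t \<in> carrier S" "u \<in> carrier S" "v \<in> carrier S"
      "a = s \<otimes>\<^bsub>S\<^esub> a'" "a' = t \<otimes>\<^bsub>S\<^esub> a" "b = b' \<otimes>\<^bsub>S\<^esub> u" "b' = b \<otimes>\<^bsub>S\<^esub> v"
    using assms unfolding S.green_L_iff S.green_R_iff by blast
  have "\<Phi> a b = \<Phi> a' b"
    using twist_left_le[OF *(1,3,6,10)] twist_left_le[OF *(2,3,5,9)] by simp
  also have "\<dots> = \<Phi> a' b'"
    using twist_right_le[OF *(2,3,8,12)] twist_right_le[OF *(2,4,7,11)] by simp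
  finally show ?thesis .
qed

lemma class_twist_le:
  assumes "e \<in> D" and "e \<otimes>\<^bsub>S\<^esub> e = e"
  shows "class_twist S \<Phi> D \<le> \<Phi> e e"
  unfolding class_twist_def using assms by (intro cInf_lower) auto

text \<open>Regularity provides an idempotent, so the set of values is non-empty and its
  \<open>Inf\<close> in the naturals is a member.\<close>

lemma class_twist_attained:
  assumes "regular_D_class S D"
  obtains e where "e \<in> D" "e \<otimes>\<^bsub>S\<^esub> e = e" "class_twist S \<Phi> D = \<Phi> e e"
proof -
  have "D \<in> carrier S // green_D S" using assms unfolding regular_D_class_def by simp
  then have "\<exists>e\<in>D. e \<otimes>\<^bsub>S\<^esub> e = e" using assms S.regular_D_class_iff_idempotent by simp
  then have "class_twist S \<Phi> D \<in> {\<Phi> e e | e. e \<in> D \<and> e \<otimes>\<^bsub>S\<^esub> e = e}"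
    unfolding class_twist_def by (intro Inf_nat_def1) auto
  then show ?thesis using that by auto
qed

section \<open>Idempotents and regular D-classes of the twisted product\<close>

lemma regular_T_imp:
  assumes H: "H \<in> carrier M // green_H M" and D: "D \<in> carrier S // green_D S"
    and i: "i \<in> H" and e: "e \<in> D"
    and idem: "(i, e) \<otimes>\<^bsub>T\<^esub> (i, e) = (i, e)"
  shows "is_group_in M H" and "regular_D_class S D" and "green_J_le M i (q [^]\<^bsub>M\<^esub> \<Phi> e e)"
proof -
  let ?k = "q [^]\<^bsub>M\<^esub> \<Phi> e e"
  have iM: "i \<in> carrier M" using in_quotient_imp_subset[OF M.equiv_green_H H] i by auto
  have kM: "?k \<in> carrier M" by simp
  have ik: "i \<otimes>\<^bsub>M\<^esub> i \<otimes>\<^bsub>M\<^esub> ?k = i" and ee: "e \<otimes>\<^bsub>S\<^esub> e = e" using idem by simp_all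
  show "regular_D_class S D" using S.regular_D_class_iff_idempotent[OF D] e ee by blast
  have "i = ?k \<otimes>\<^bsub>M\<^esub> (i \<otimes>\<^bsub>M\<^esub> i)" using ik M.m_comm[OF kM M.m_closed[OF iM iM]] by simp
  then show "green_J_le M i ?k" using M.green_J_le_iff[OF iM kM] M.m_closed[OF iM iM] by blast
  \<comment> \<open>In additive terms idempotency says \<open>i + ?f = i\<close>, so
    \<open>?f\<close> is the candidate for the identity of \<open>H\<close>.\<close>
  let ?f = "i \<otimes>\<^bsub>M\<^esub> ?k"
  have "?f \<otimes>\<^bsub>M\<^esub> i = i \<otimes>\<^bsub>M\<^esub> i \<otimes>\<^bsub>M\<^esub> ?k" using iM kM by (simp add: M.m_ac)
  with ik have fi: "?f \<otimes>\<^bsub>M\<^esub> i = i" by simp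
  have "?f \<otimes>\<^bsub>M\<^esub> ?f = ?f \<otimes>\<^bsub>M\<^esub> i \<otimes>\<^bsub>M\<^esub> ?k" using iM kM by (intro M.m_assoc[symmetric]) simp_all
  then have ff: "?f \<otimes>\<^bsub>M\<^esub> ?f = ?f" using fi by simp
  have "(i, ?f) \<in> green_H M"
    unfolding M.green_H_iff using fi[symmetric] iM kM M.m_closed[OF iM kM] by blast
  then have "?f \<in> H" using quotient_eq_Image[OF M.equiv_green_H H i] by simp
  then show "is_group_in M H" using M.is_group_in_green_H_class_iff[OF H] ff by blast
qed

text \<open>Let \<open>b\<close> be the inverse of h + \<Phi>(e,e)q in the group of
  \<open>h\<close>. Adding the identity \<open>h\<close> to b + b + \<Phi>(e,e)q lets one copy of
  \<open>b\<close> cancel, which leaves \<open>b\<close>.\<close>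

lemma idempotent_T_exists:
  assumes h: "h \<in> carrier M" "h \<otimes>\<^bsub>M\<^esub> h = h" and e: "e \<otimes>\<^bsub>S\<^esub> e = e"
    and le: "green_J_le M h (q [^]\<^bsub>M\<^esub> \<Phi> e e)"
  obtains i where "(h, i) \<in> green_H M" "(i, e) \<otimes>\<^bsub>T\<^esub> (i, e) = (i, e)"
proof -
  let ?k = "q [^]\<^bsub>M\<^esub> \<Phi> e e"
  have kM: "?k \<in> carrier M" by simp
  have "(h, h \<otimes>\<^bsub>M\<^esub> ?k) \<in> green_H M" using M.mem_group_class_iff_J_le[OF h kM] le by simp
  then obtain b where b: "b \<in> carrier M" "h \<otimes>\<^bsub>M\<^esub> b = b" "h \<otimes>\<^bsub>M\<^esub> ?k \<otimes>\<^bsub>M\<^esub> b = h"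
    using M.green_H_idempotent_iff[OF h] by blast
  have "b \<otimes>\<^bsub>M\<^esub> (h \<otimes>\<^bsub>M\<^esub> ?k) = h" using b(1,3) h(1) kM M.m_comm[of b "h \<otimes>\<^bsub>M\<^esub> ?k"] by simp
  then have hb: "(h, b) \<in> green_H M"
    using M.green_H_idempotent_comm_iff[OF h] b(1,2) M.m_closed[OF h(1) kM] by blast
  have "b \<otimes>\<^bsub>M\<^esub> b \<otimes>\<^bsub>M\<^esub> ?k = (h \<otimes>\<^bsub>M\<^esub> b) \<otimes>\<^bsub>M\<^esub> b \<otimes>\<^bsub>M\<^esub> ?k" using b(2) by simp
  also have "\<dots> = (h \<otimes>\<^bsub>M\<^esub> ?k \<otimes>\<^bsub>M\<^esub> b) \<otimes>\<^bsub>M\<^esub> b" using b(1) h(1) kM by (simp add: M.m_ac)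
  also have "\<dots> = b" using b(2,3) by simp
  finally have "b \<otimes>\<^bsub>M\<^esub> b \<otimes>\<^bsub>M\<^esub> ?k = b" .
  then show ?thesis using that hb e by simp
qed

lemma regular_T_iff:
  assumes H: "H \<in> carrier M // green_H M" and D: "D \<in> carrier S // green_D S"
  shows "regular_D_class T (H \<times> D) \<longleftrightarrow> is_group_in M H \<and> regular_D_class S D \<and>
    (\<exists>i\<in>H. green_J_le M i (q [^]\<^bsub>M\<^esub> class_twist S \<Phi> D))" (is "?l \<longleftrightarrow> ?r")
proof
  assume ?l
  then obtain i e where ie: "i \<in> H" "e \<in> D" "(i, e) \<otimes>\<^bsub>T\<^esub> (i, e) = (i, e)"
    using T.regular_D_class_iff_idempotent[OF product_D_class[OF H D]] by auto
  have iM: "i \<in> carrier M" using in_quotient_imp_subset[OF M.equiv_green_H H] ie by auto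
  let ?c = "class_twist S \<Phi> D"
  \<comment> \<open>This \<open>e\<close> need not attain the minimum; the surplus multiple of
    \<open>q\<close> is moved into the cofactor.\<close>
  have "?c \<le> \<Phi> e e" using class_twist_le ie by simp
  then have split: "q [^]\<^bsub>M\<^esub> \<Phi> e e = q [^]\<^bsub>M\<^esub> ?c \<otimes>\<^bsub>M\<^esub> q [^]\<^bsub>M\<^esub> (\<Phi> e e - ?c)"
    by (simp add: M.nat_pow_mult)
  obtain l where l: "l \<in> carrier M" "i = q [^]\<^bsub>M\<^esub> \<Phi> e e \<otimes>\<^bsub>M\<^esub> l"
    using regular_T_imp(3)[OF H D ie] unfolding M.green_J_le_iff[OF iM M.nat_pow_closed[OF q_closed]]
    by (elim bexE)
  have "i = q [^]\<^bsub>M\<^esub> ?c \<otimes>\<^bsub>M\<^esub> (q [^]\<^bsub>M\<^esub> (\<Phi> e e - ?c) \<otimes>\<^bsub>M\<^esub> l)"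
    unfolding l(2) split using l(1) by (intro M.m_assoc) simp_all
  moreover have "q [^]\<^bsub>M\<^esub> (\<Phi> e e - ?c) \<otimes>\<^bsub>M\<^esub> l \<in> carrier M" using l(1) by simp
  ultimately have "green_J_le M i (q [^]\<^bsub>M\<^esub> ?c)"
    using M.green_J_le_iff[OF iM M.nat_pow_closed[OF q_closed, of ?c]] by blast
  then show ?r using regular_T_imp(1,2)[OF H D ie] ie by blast
next
  assume r: ?r
  then obtain h where h: "h \<in> H" "h \<otimes>\<^bsub>M\<^esub> h = h" using M.is_group_in_green_H_class_iff[OF H] by blast
  have hM: "h \<in> carrier M" using in_quotient_imp_subset[OF M.equiv_green_H H] h by auto
  \<comment> \<open>An idempotent attaining the minimum is chosen, so the assumed bound is exactly
    the one needed to build an idempotent of \<open>T\<close> over \<open>e\<close>.\<close>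
  obtain e where e: "e \<in> D" "e \<otimes>\<^bsub>S\<^esub> e = e" "class_twist S \<Phi> D = \<Phi> e e"
    using r class_twist_attained by metis
  have "green_J_le M h (q [^]\<^bsub>M\<^esub> \<Phi> e e)"
    using r e(3) M.green_J_le_class(1)[OF H h(1) M.nat_pow_closed[OF q_closed]] by metis
  then obtain i where i: "(h, i) \<in> green_H M" "(i, e) \<otimes>\<^bsub>T\<^esub> (i, e) = (i, e)"
    using idempotent_T_exists[OF hM h(2) e(2)] by blast
  then have "(i, e) \<in> H \<times> D" using quotient_eq_Image[OF M.equiv_green_H H h(1)] e(1) by simp
  then show ?l
    using T.regular_D_class_iff_idempotent[OF product_D_class[OF H D]] i(2) by blast
qed

section \<open>The structure of the group H-classes of the twisted product\<close>

lemma group_H_class_T_iso: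
  assumes H: "H \<in> carrier M // green_H M" and D: "D \<in> carrier S // green_D S"
    and K: "group_H_class T K" "K \<subseteq> H \<times> D" and G: "group_H_class S G" "G \<subseteq> D"
  shows "T \<restriction> K \<cong> (M \<restriction> H) \<times>\<times> (S \<restriction> G)"
proof -
  obtain x where x: "x \<in> carrier T" "x \<in> K" "x \<otimes>\<^bsub>T\<^esub> x = x" "K = green_H T `` {x}"
    using T.group_H_class_idempotent[OF K(1)] .
  obtain j e where xje: "x = (j, e)" by (cases x)
  then have je: "j \<in> H" "e \<in> D" "(j, e) \<otimes>\<^bsub>T\<^esub> (j, e) = (j, e)" "e \<otimes>\<^bsub>S\<^esub> e = e"
    using x K(2) by auto
  have eS: "e \<in> carrier S" using x(1) xje by simp
  \<comment> \<open>The idempotent \<open>(j, e)\<close> of \<open>K\<close> singles out the group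
    H-class of \<open>e\<close> as second factor of \<open>K\<close>.\<close>
  define L where "L = green_H S `` {e}"
  have KL: "K = H \<times> L"
    unfolding x(4) xje L_def quotient_eq_Image[OF M.equiv_green_H H je(1)]
    by (auto simp: green_H_T_iff)
  have L: "group_H_class S L" "L \<subseteq> D"
    unfolding L_def using S.group_H_class_Image[OF eS je(4)] S.green_H_Image_subset_D_class[OF D je(2)]
    by auto
  \<comment> \<open>The given \<open>G\<close> may differ from \<open>L\<close>, but both are group
    H-classes in \<open>D\<close>, hence isomorphic.\<close>
  obtain g where g: "g \<in> iso (S \<restriction> L) (S \<restriction> G)"
    using S.group_H_classes_iso[OF L(1) G(1) D L(2) G(2)] unfolding is_iso_def by blast
  let ?k = "q [^]\<^bsub>M\<^esub> \<Phi> e e"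
  have kM: "?k \<in> carrier M" by simp
  obtain h where h: "h \<in> H" "h \<otimes>\<^bsub>M\<^esub> h = h"
    using regular_T_imp(1)[OF H D je(1,2,3)] M.is_group_in_green_H_class_iff[OF H] by blast
  have HM: "H \<subseteq> carrier M" using in_quotient_imp_subset[OF M.equiv_green_H H] .
  then have hM: "h \<in> carrier M" using h by auto
  have "green_J_le M h ?k"
    using regular_T_imp(3)[OF H D je(1,2,3)] M.green_J_le_class(1)[OF H h(1) kM] je(1) by blast
  then have bij: "bij_betw (\<lambda>i. i \<otimes>\<^bsub>M\<^esub> ?k) H H"
    using M.bij_betw_translate[OF hM h(2) quotient_eq_Image[OF M.equiv_green_H H h(1)] kM] by simp
  have "bij_betw g L G" using g unfolding iso_def by simp
  \<comment> \<open>The isomorphism shifts the first component by \<Phi>(e,e)q to untwist it and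
    carries the second from \<open>L\<close> to \<open>G\<close>.\<close>
  with bij have bij': "bij_betw (map_prod (\<lambda>i. i \<otimes>\<^bsub>M\<^esub> ?k) g) (H \<times> L) (H \<times> G)"
    by (rule bij_betw_map_prod)
  \<comment> \<open>All members of \<open>L\<close> are both L- and R-related to \<open>e\<close>,
    so the twist is constant there.\<close>
  have twist: "\<Phi> a b = \<Phi> e e" if "a \<in> L" "b \<in> L" for a b
    using that twist_eq[of e a e b] unfolding L_def green_H_def by simp
  have hom: "map_prod (\<lambda>i. i \<otimes>\<^bsub>M\<^esub> ?k) g (y \<otimes>\<^bsub>T\<^esub> z) =
      map_prod (\<lambda>i. i \<otimes>\<^bsub>M\<^esub> ?k) g y \<otimes>\<^bsub>(M \<restriction> H) \<times>\<times> (S \<restriction> G)\<^esub> map_prod (\<lambda>i. i \<otimes>\<^bsub>M\<^esub> ?k) g z"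
    if y: "y \<in> H \<times> L" and z: "z \<in> H \<times> L" for y z
  proof -
    obtain i a l b where yz: "y = (i, a)" "z = (l, b)" "i \<in> H" "l \<in> H" "a \<in> L" "b \<in> L"
      using y z by blast
    have "g (a \<otimes>\<^bsub>S\<^esub> b) = g a \<otimes>\<^bsub>S\<^esub> g b"
      using g yz(5,6) unfolding iso_def hom_def by simp
    \<comment> \<open>The twist of the product and the shift of its image together supply one shift
      for each factor.\<close>
    moreover have "i \<otimes>\<^bsub>M\<^esub> l \<otimes>\<^bsub>M\<^esub> ?k \<otimes>\<^bsub>M\<^esub> ?k = i \<otimes>\<^bsub>M\<^esub> ?k \<otimes>\<^bsub>M\<^esub> (l \<otimes>\<^bsub>M\<^esub> ?k)"
      using yz(3,4) HM kM by (simp add: M.m_ac subset_iff)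
    ultimately show ?thesis unfolding yz(1,2) using twist[OF yz(5,6)] by simp
  qed
  have "map_prod (\<lambda>i. i \<otimes>\<^bsub>M\<^esub> ?k) g \<in> iso (T \<restriction> K) ((M \<restriction> H) \<times>\<times> (S \<restriction> G))"
    using bij' hom bij_betwE[OF bij'] unfolding KL iso_def hom_def by auto
  then show ?thesis unfolding is_iso_def by blast
qed

end

theorem theorem7p1:
  fixes M :: "('m, 'x) monoid_scheme" and S :: "('s, 'y) monoid_scheme"
    and \<Phi> :: "'s \<Rightarrow> 's \<Rightarrow> nat" and q :: 'm
    and T :: "('m \<times> 's) monoid" and H :: "'m set" and D :: "'s set"
  assumes "comm_monoid M" and "monoid S" and "q \<in> carrier M"
    and "tight_twisting S \<Phi>"
    and "T = twisted_product M q \<Phi> S"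
    and "H \<in> carrier M // green_H M"
    and "D \<in> carrier S // green_D S"
  shows
    "(regular_D_class T (H \<times> D) \<longleftrightarrow>
        is_group_in M H \<and> regular_D_class S D \<and>
        H = H #>\<^bsub>M\<^esub> (q [^]\<^bsub>M\<^esub> class_twist S \<Phi> D)) \<and>
     (regular_D_class T (H \<times> D) \<longleftrightarrow>
        is_group_in M H \<and> regular_D_class S D \<and>
        (\<exists>i\<in>H. green_J_le M i (q [^]\<^bsub>M\<^esub> class_twist S \<Phi> D))) \<and>
     (regular_D_class T (H \<times> D) \<longleftrightarrow>
        is_group_in M H \<and> regular_D_class S D \<and>
        (class_twist S \<Phi> D = 0 \<or> (\<exists>i\<in>H. green_J_le M i q))) \<and>
     (regular_D_class S D \<longrightarrow>
        ((\<exists>i\<in>H. green_J_le M i (q [^]\<^bsub>M\<^esub> class_twist S \<Phi> D)) \<longleftrightarrow>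
         (\<forall>i\<in>H. green_J_le M i (q [^]\<^bsub>M\<^esub> class_twist S \<Phi> D)))) \<and>
     ((\<exists>i\<in>H. green_J_le M i q) \<longleftrightarrow> (\<forall>i\<in>H. green_J_le M i q)) \<and>
     (regular_D_class T (H \<times> D) \<longrightarrow>
        (\<exists>G. group_H_class S G \<and> G \<subseteq> D) \<and>
        (\<forall>K. group_H_class T K \<and> K \<subseteq> H \<times> D \<longrightarrow>
          (\<forall>G. group_H_class S G \<and> G \<subseteq> D \<longrightarrow>
            T \<restriction> K \<cong> (M \<restriction> H) \<times>\<times> (S \<restriction> G))))"
proof -
  interpret tight_twisted_product M S q \<Phi>
    using assms by (simp add: tight_twisted_product_def tight_twisted_product_axioms_def)
  note H = assms(6) and D = assms(7)
  let ?c = "class_twist S \<Phi> D"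
  let ?J = "\<exists>i\<in>H. green_J_le M i (q [^]\<^bsub>M\<^esub> ?c)"
  have kM: "q [^]\<^bsub>M\<^esub> ?c \<in> carrier M" by simp
  have T: "regular_D_class T (H \<times> D) \<longleftrightarrow> is_group_in M H \<and> regular_D_class S D \<and> ?J"
    unfolding assms(5) by (rule regular_T_iff[OF H D])
  \<comment> \<open>Given a group \<open>H\<close>, each condition on the class is evaluated at its
    identity \<open>h\<close>, where all become statements about \<open>h\<close> in the
    J-order.\<close>
  have J: "(H = H #>\<^bsub>M\<^esub> (q [^]\<^bsub>M\<^esub> ?c) \<longleftrightarrow> ?J) \<and>
      (?J \<longleftrightarrow> ?c = 0 \<or> (\<exists>i\<in>H. green_J_le M i q))" if group: "is_group_in M H"
  proof -
    obtain h where h: "h \<in> H" "h \<otimes>\<^bsub>M\<^esub> h = h"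
      using group M.is_group_in_green_H_class_iff[OF H] by blast
    have hM: "h \<in> carrier M" using in_quotient_imp_subset[OF M.equiv_green_H H] h by auto
    show ?thesis
      unfolding M.green_J_le_class(1)[OF H h(1) kM] M.green_J_le_class(1)[OF H h(1) q_closed]
      using M.translate_eq_iff_J_le[OF hM h(2) quotient_eq_Image[OF M.equiv_green_H H h(1)] kM]
        M.idempotent_J_le_pow_iff[OF hM h(2) q_closed] by blast
  qed
  obtain i where i: "i \<in> H" using in_quotient_imp_non_empty[OF M.equiv_green_H H] by blast
  \<comment> \<open>Both quantifiers amount to the condition at the chosen \<open>i\<close>.\<close>
  have "?J \<longleftrightarrow> (\<forall>i\<in>H. green_J_le M i (q [^]\<^bsub>M\<^esub> ?c))"
    unfolding M.green_J_le_class[OF H i kM] ..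
  moreover have "(\<exists>i\<in>H. green_J_le M i q) \<longleftrightarrow> (\<forall>i\<in>H. green_J_le M i q)"
    unfolding M.green_J_le_class[OF H i q_closed] ..
  moreover have "\<exists>G. group_H_class S G \<and> G \<subseteq> D" if "regular_D_class S D"
    using S.regular_D_class_contains_group_H_class[OF that] by blast
  moreover have "T \<restriction> K \<cong> (M \<restriction> H) \<times>\<times> (S \<restriction> G)"
    if "group_H_class T K" "K \<subseteq> H \<times> D" "group_H_class S G" "G \<subseteq> D" for K G
    using group_H_class_T_iso[OF H D] that unfolding assms(5) by blast
  ultimately show ?thesis using T J by (intro conjI impI allI) blast+
qed

end
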